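(* The functor $Ext:\mathbf{[0,1]}\text{-}\mathbf{TopSys}\to\mathbf{[0,1]}\text{-}\mathbf{Top}$, given by $Ext(X,\models,A)=(X,ext(A))$ and $Ext(f_1,f_2)=f_1$, is right adjoint to the functor $J:\mathbf{[0,1]}\text{-}\mathbf{Top}\to\mathbf{[0,1]}\text{-}\mathbf{TopSys}$, given by $J(X,\tau)=(X,\in,\tau)$ and $J(f)=(f,f^{-1})$.
   Context: A frame is a poset with arbitrary joins and finite meets (including the empty ones) in which binary meets distribute over arbitrary joins; a frame homomorphism preserves arbitrary joins and finite meets. $[0,1]$ carries its usual order. $\mathbf{[0,1]}$-$\mathbf{Top}$: objects are fuzzy topological spaces $(X,\tau)$, where $X$ is a set and $\tau$ is a collection of maps $X\to[0,1]$ (fuzzy subsets of $X$) containing the constants $0$ and $1$ and closed under arbitrary pointwise suprema and binary pointwise minima. A morphism $(X,\tau_1)\to(Y,\tau_2)$ is a function $f:X\to Y$ such that $f^{-1}(\tilde B):=\tilde B\circ f\in\tau_1$ for every $\tilde B\in\tau_2$. $\mathbf{[0,1]}$-$\mathbf{TopSys}$: objects are fuzzy topological systems $(X,\models,A)$, where $X$ is a non-empty set, $A$ is a frame and $\models$ is a fuzzy relation from $X$ to $A$, i.e. a function $(x,a)\mapsto gr(x\models a)\in[0,1]$, such that $gr(x\models\bigwedge S)=\inf\{gr(x\models s): s\in S\}$ for every finite $S\subseteq A$ and $gr(x\models\bigvee S)=\sup\{gr(x\models s): s\in S\}$ for every $S\subseteq A$ (with $\inf\emptyset=1$, $\sup\emptyset=0$).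 A morphism $(X,\models,A)\to(Y,\models',B)$ is a pair $(f_1,f_2)$ with $f_1:X\to Y$ a function and $f_2:B\to A$ a frame homomorphism such that $gr(x\models f_2(b))=gr(f_1(x)\models' b)$ for all $x\in X$, $b\in B$. Composition is $(g_1,g_2)\circ(f_1,f_2)=(g_1\circ f_1,f_2\circ g_2)$. For a system $(X,\models,A)$ and $a\in A$, $ext(a):X\to[0,1]$ is $ext(a)(x)=gr(x\models a)$, and $ext(A)=\{ext(a):a\in A\}$. In $(X,\in,\tau)$ one puts $gr(x\in\tilde T)=\tilde T(x)$, and $\tau$ is a frame under the pointwise order.
   Formalization: Fuzzy topological spaces are required to have a non-empty underlying set, since for the empty space J(X,τ) would have an empty underlying set and so would not be a fuzzy topological system. *)

theory Defs
  imports "HOL-Algebra.Complete_Lattice" Complex_Main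
begin

section \<open>Categories, functors, adjoints\<close>

text \<open>
  Categories are given by hom-sets indexed by pairs of objects; distinct hom-sets may share
  underlying arrows. For this reason composition is indexed by the three objects involved, and the
  arrow part of a functor by domain and codomain. \<open>comp C a b c g f\<close> is \<open>g\<close> after \<open>f\<close>,
  for \<open>f\<close> from \<open>a\<close> to \<open>b\<close> and \<open>g\<close> from \<open>b\<close> to \<open>c\<close>.
\<close>

record ('o, 'm) category =
  Ob :: "'o set"
  Hom :: "'o \<Rightarrow> 'o \<Rightarrow> 'm set"
  Id :: "'o \<Rightarrow> 'm"
  comp :: "'o \<Rightarrow> 'o \<Rightarrow> 'o \<Rightarrow> 'm \<Rightarrow> 'm \<Rightarrow> 'm"

definition is_category :: "('o, 'm) category \<Rightarrow> bool" where
  "is_category C \<longleftrightarrow>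
     (\<forall>a\<in>Ob C. Id C a \<in> Hom C a a) \<and>
     (\<forall>a\<in>Ob C. \<forall>b\<in>Ob C. \<forall>c\<in>Ob C. \<forall>f\<in>Hom C a b. \<forall>g\<in>Hom C b c.
        comp C a b c g f \<in> Hom C a c) \<and>
     (\<forall>a\<in>Ob C. \<forall>b\<in>Ob C. \<forall>f\<in>Hom C a b.
        comp C a a b f (Id C a) = f \<and> comp C a b b (Id C b) f = f) \<and>
     (\<forall>a\<in>Ob C. \<forall>b\<in>Ob C. \<forall>c\<in>Ob C. \<forall>d\<in>Ob C.
        \<forall>f\<in>Hom C a b. \<forall>g\<in>Hom C b c. \<forall>h\<in>Hom C c d.
        comp C a c d h (comp C a b c g f) = comp C a b d (comp C b c d h g) f)"

record ('o1, 'm1, 'o2, 'm2) fctr =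
  on_ob :: "'o1 \<Rightarrow> 'o2"
  on_hom :: "'o1 \<Rightarrow> 'o1 \<Rightarrow> 'm1 \<Rightarrow> 'm2"

definition is_functor ::
  "('o1, 'm1) category \<Rightarrow> ('o2, 'm2) category \<Rightarrow> ('o1, 'm1, 'o2, 'm2) fctr \<Rightarrow> bool" where
  "is_functor C D F \<longleftrightarrow>
     is_category C \<and> is_category D \<and>
     (\<forall>a\<in>Ob C. on_ob F a \<in> Ob D) \<and>
     (\<forall>a\<in>Ob C. \<forall>b\<in>Ob C. \<forall>f\<in>Hom C a b. on_hom F a b f \<in> Hom D (on_ob F a) (on_ob F b)) \<and>
     (\<forall>a\<in>Ob C. on_hom F a a (Id C a) = Id D (on_ob F a)) \<and>
     (\<forall>a\<in>Ob C. \<forall>b\<in>Ob C. \<forall>c\<in>Ob C. \<forall>f\<in>Hom C a b. \<forall>g\<in>Hom C b c.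
        on_hom F a c (comp C a b c g f) =
        comp D (on_ob F a) (on_ob F b) (on_ob F c) (on_hom F b c g) (on_hom F a b f))"

text \<open>\<open>is_right_adjoint C D F G\<close>: the functor \<open>G\<close> from \<open>D\<close> to \<open>C\<close> is right adjoint to the functor
  \<open>F\<close> from \<open>C\<close> to \<open>D\<close>, by a bijection of \<open>D(F c, d)\<close> with \<open>C(c, G d)\<close> natural in \<open>c\<close> and \<open>d\<close>.\<close>

definition is_right_adjoint ::
  "('o1, 'm1) category \<Rightarrow> ('o2, 'm2) category \<Rightarrow>
   ('o1, 'm1, 'o2, 'm2) fctr \<Rightarrow> ('o2, 'm2, 'o1, 'm1) fctr \<Rightarrow> bool" where
  "is_right_adjoint C D F G \<longleftrightarrow>
     is_functor C D F \<and> is_functor D C G \<and>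
     (\<exists>\<phi>.
       (\<forall>c\<in>Ob C. \<forall>d\<in>Ob D. bij_betw (\<phi> c d) (Hom D (on_ob F c) d) (Hom C c (on_ob G d))) \<and>
       (\<forall>c'\<in>Ob C. \<forall>c\<in>Ob C. \<forall>d\<in>Ob D. \<forall>h\<in>Hom C c' c. \<forall>g\<in>Hom D (on_ob F c) d.
          \<phi> c' d (comp D (on_ob F c') (on_ob F c) d g (on_hom F c' c h)) =
          comp C c' c (on_ob G d) (\<phi> c d g) h) \<and>
       (\<forall>c\<in>Ob C. \<forall>d\<in>Ob D. \<forall>d'\<in>Ob D. \<forall>k\<in>Hom D d d'. \<forall>g\<in>Hom D (on_ob F c) d.
          \<phi> c d' (comp D (on_ob F c) d d' k g) =
          comp C c (on_ob G d) (on_ob G d') (on_hom G d d' k) (\<phi> c d g)))"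


section \<open>Frames\<close>

definition is_frame :: "'a gorder \<Rightarrow> bool" where
  "is_frame L \<longleftrightarrow>
     partial_order L \<and>
     (\<forall>S. S \<subseteq> carrier L \<longrightarrow> (\<exists>s. is_lub L s S)) \<and>
     (\<forall>S. finite S \<and> S \<subseteq> carrier L \<longrightarrow> (\<exists>i. is_glb L i S)) \<and>
     (\<forall>a\<in>carrier L. \<forall>S. S \<subseteq> carrier L \<longrightarrow>
        a \<sqinter>\<^bsub>L\<^esub> (\<Squnion>\<^bsub>L\<^esub> S) = \<Squnion>\<^bsub>L\<^esub> ((\<lambda>s. a \<sqinter>\<^bsub>L\<^esub> s) ` S))"

text \<open>Here and below, maps between carrier sets are taken extensional (\<open>\<rightarrow>\<^sub>E\<close>), so that equality in HOL
  is equality of maps on their domain.\<close>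

definition frame_hom :: "'a gorder \<Rightarrow> 'b gorder \<Rightarrow> ('a \<Rightarrow> 'b) set" where
  "frame_hom L M = {f \<in> carrier L \<rightarrow>\<^sub>E carrier M.
     (\<forall>S. S \<subseteq> carrier L \<longrightarrow> f (\<Squnion>\<^bsub>L\<^esub> S) = \<Squnion>\<^bsub>M\<^esub> (f ` S)) \<and>
     (\<forall>S. finite S \<and> S \<subseteq> carrier L \<longrightarrow> f (\<Sqinter>\<^bsub>L\<^esub> S) = \<Sqinter>\<^bsub>M\<^esub> (f ` S))}"


section \<open>Fuzzy topological spaces\<close>

text \<open>Supremum and infimum in \<open>[0,1]\<close>: \<open>Sup {}\<close> and \<open>Inf {}\<close> are unspecified for reals.\<close>

definition sup01 :: "real set \<Rightarrow> real" where
  "sup01 R = (if R = {} then 0 else Sup R)"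

definition inf01 :: "real set \<Rightarrow> real" where
  "inf01 R = (if R = {} then 1 else Inf R)"

record 'x fuzzy_space =
  points :: "'x set"
  opens :: "('x \<Rightarrow> real) set"

text \<open>Underlying sets are non-empty, as they have to be for topological systems: otherwise \<open>J\<close>
  below would not take values in topological systems.\<close>

definition is_fuzzy_space :: "'x fuzzy_space \<Rightarrow> bool" where
  "is_fuzzy_space X \<longleftrightarrow>
     points X \<noteq> {} \<and>
     opens X \<subseteq> points X \<rightarrow>\<^sub>E {0..1} \<and>
     (\<lambda>x\<in>points X. 0) \<in> opens X \<and>
     (\<lambda>x\<in>points X. 1) \<in> opens X \<and>
     (\<forall>\<S>. \<S> \<subseteq> opens X \<longrightarrow> (\<lambda>x\<in>points X. sup01 ((\<lambda>T. T x) ` \<S>)) \<in> opens X) \<and>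
     (\<forall>S\<in>opens X. \<forall>T\<in>opens X. (\<lambda>x\<in>points X. min (S x) (T x)) \<in> opens X)"

definition fuzzy_preimage ::
  "'x fuzzy_space \<Rightarrow> ('x \<Rightarrow> 'y) \<Rightarrow> ('y \<Rightarrow> real) \<Rightarrow> ('x \<Rightarrow> real)" where
  "fuzzy_preimage X f T = compose (points X) T f"

definition fuzzy_continuous :: "'x fuzzy_space \<Rightarrow> 'y fuzzy_space \<Rightarrow> ('x \<Rightarrow> 'y) set" where
  "fuzzy_continuous X Y = {f \<in> points X \<rightarrow>\<^sub>E points Y. \<forall>T\<in>opens Y. fuzzy_preimage X f T \<in> opens X}"

definition fuzzy_Top :: "('x fuzzy_space, 'x \<Rightarrow> 'x) category" where
  "fuzzy_Top = \<lparr>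
     Ob = {X. is_fuzzy_space X},
     Hom = fuzzy_continuous,
     Id = (\<lambda>X. \<lambda>x\<in>points X. x),
     comp = (\<lambda>X Y Z g f. compose (points X) g f)\<rparr>"


section \<open>Fuzzy topological systems\<close>

record ('x, 'a) fuzzy_system =
  pts :: "'x set"
  gr :: "'x \<Rightarrow> 'a \<Rightarrow> real"
  frm :: "'a gorder"

definition is_fuzzy_system :: "('x, 'a) fuzzy_system \<Rightarrow> bool" where
  "is_fuzzy_system S \<longleftrightarrow>
     pts S \<noteq> {} \<and>
     is_frame (frm S) \<and>
     gr S \<in> pts S \<rightarrow>\<^sub>E (carrier (frm S) \<rightarrow>\<^sub>E {0..1}) \<and>
     (\<forall>x\<in>pts S. \<forall>B. finite B \<and> B \<subseteq> carrier (frm S) \<longrightarrow>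
        gr S x (\<Sqinter>\<^bsub>frm S\<^esub> B) = inf01 (gr S x ` B)) \<and>
     (\<forall>x\<in>pts S. \<forall>B. B \<subseteq> carrier (frm S) \<longrightarrow>
        gr S x (\<Squnion>\<^bsub>frm S\<^esub> B) = sup01 (gr S x ` B))"

definition system_hom ::
  "('x, 'a) fuzzy_system \<Rightarrow> ('y, 'b) fuzzy_system \<Rightarrow> (('x \<Rightarrow> 'y) \<times> ('b \<Rightarrow> 'a)) set" where
  "system_hom S T = {(f1, f2).
     f1 \<in> pts S \<rightarrow>\<^sub>E pts T \<and>
     f2 \<in> frame_hom (frm T) (frm S) \<and>
     (\<forall>x\<in>pts S. \<forall>b\<in>carrier (frm T). gr S x (f2 b) = gr T (f1 x) b)}"

definition fuzzy_TopSys :: "(('x, 'a) fuzzy_system, ('x \<Rightarrow> 'x) \<times> ('a \<Rightarrow> 'a)) category" where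
  "fuzzy_TopSys = \<lparr>
     Ob = {S. is_fuzzy_system S},
     Hom = system_hom,
     Id = (\<lambda>S. (\<lambda>x\<in>pts S. x, \<lambda>a\<in>carrier (frm S). a)),
     comp = (\<lambda>S T U g f.
       (compose (pts S) (fst g) (fst f), compose (carrier (frm U)) (snd f) (snd g)))\<rparr>"


section \<open>The functors Ext and J\<close>

definition ext :: "('x, 'a) fuzzy_system \<Rightarrow> 'a \<Rightarrow> ('x \<Rightarrow> real)" where
  "ext S a = (\<lambda>x\<in>pts S. gr S x a)"

definition Ext ::
  "(('x, 'a) fuzzy_system, ('x \<Rightarrow> 'x) \<times> ('a \<Rightarrow> 'a), 'x fuzzy_space, 'x \<Rightarrow> 'x) fctr" where
  "Ext = \<lparr>
     on_ob = (\<lambda>S. \<lparr>points = pts S, opens = ext S ` carrier (frm S)\<rparr>),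
     on_hom = (\<lambda>S T f. fst f)\<rparr>"

text \<open>
  The frames of systems live in one type \<open>'a\<close>, which stands for an arbitrarily large universe.
  The frame of \<open>J X\<close> is \<open>opens X\<close> with the pointwise order, so fuzzy subsets must be elements of
  that universe; the injection \<open>\<iota>\<close> regards them as such. For \<open>'a = ('x \<Rightarrow> real)\<close> and \<open>\<iota> = id\<close>
  the frame is literally \<open>opens X\<close>; other choices, such as \<open>Inr\<close> into \<open>'b + ('x \<Rightarrow> real)\<close>, make
  room for frames of any size.
\<close>

definition opens_frame :: "(('x \<Rightarrow> real) \<Rightarrow> 'a) \<Rightarrow> 'x fuzzy_space \<Rightarrow> 'a gorder" where
  "opens_frame \<iota> X = \<lparr>
     carrier = \<iota> ` opens X,
     eq = (=),
     le = (\<lambda>u v. \<exists>S\<in>opens X. \<exists>T\<in>opens X. u = \<iota> S \<and> v = \<iota> T \<and> (\<forall>x\<in>points X. S x \<le> T x))\<rparr>"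

definition J ::
  "(('x \<Rightarrow> real) \<Rightarrow> 'a) \<Rightarrow>
   ('x fuzzy_space, 'x \<Rightarrow> 'x, ('x, 'a) fuzzy_system, ('x \<Rightarrow> 'x) \<times> ('a \<Rightarrow> 'a)) fctr" where
  "J \<iota> = \<lparr>
     on_ob = (\<lambda>X. \<lparr>pts = points X,
                    gr = (\<lambda>x\<in>points X. \<lambda>u\<in>\<iota> ` opens X. inv \<iota> u x),
                    frm = opens_frame \<iota> X\<rparr>),
     on_hom = (\<lambda>X Y f. (f, \<lambda>u\<in>\<iota> ` opens Y. \<iota> (fuzzy_preimage X f (inv \<iota> u))))\<rparr>"

end

theory Submission
  imports Defs
begin

text \<open>
  The adjunction is witnessed by the forgetful map \<open>(f1, f2) \<mapsto> f1\<close>. It is well defined because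
  \<open>f1\<close> pulls \<open>ext S a\<close> back to \<open>ext (J X) (f2 a)\<close> for every morphism \<open>(f1, f2)\<close> from \<open>J X\<close>
  to \<open>S\<close>, and it is natural because both functors and both compositions treat the underlying point
  maps in the same way. All that needs an argument is that it is bijective: each continuous
  \<open>f1\<close> from \<open>X\<close> to \<open>Ext S\<close> has exactly one companion \<open>f2\<close>.

  The reason is that \<open>J X\<close> is spatial: an element of its frame is a fuzzy open set, so it is
  determined by its degrees of satisfaction (\<open>J_spatial\<close>). The condition
  \<open>gr (J X) x (f2 a) = gr S (f1 x) a\<close> then leaves no choice but to let \<open>f2 a\<close> be the preimage of
  \<open>ext S a\<close> under \<open>f1\<close>. Conversely, this map is a frame homomorphism for free: joins and finite
  meets are computed pointwise by the degrees of satisfaction in every system, the degrees of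
  \<open>f2 a\<close> are those of \<open>a\<close> along \<open>f1\<close>, and in a spatial system two elements with the same degrees
  are equal (\<open>spatial_system_homI\<close>). The resulting description of the morphisms out of \<open>J X\<close> is
  \<open>hom_from_J_iff\<close>. Since \<open>Ext (J X) = X\<close>, it also shows that \<open>J f\<close> is a morphism of systems, and
  its uniqueness part yields the functor laws of \<open>J\<close>.

  What remains is that \<open>J X\<close> is a system at all. Here the point is that arbitrary joins and finite
  meets of fuzzy open sets are pointwise, so that frame distributivity reduces to distributivity of
  binary minima over suprema in \<open>[0,1]\<close>.
\<close>

section \<open>Suprema and finite infima in the unit interval\<close>

lemma sup01_upper: "R \<subseteq> {0..1} \<Longrightarrow> r \<in> R \<Longrightarrow> r \<le> sup01 R"
  by (auto simp: sup01_def intro!: cSup_upper bdd_aboveI[of _ 1])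

lemma sup01_least: "(\<And>r. r \<in> R \<Longrightarrow> r \<le> c) \<Longrightarrow> 0 \<le> c \<Longrightarrow> sup01 R \<le> c"
  by (auto simp: sup01_def intro!: cSup_least)

lemma sup01_nonneg: "R \<subseteq> {0..1} \<Longrightarrow> 0 \<le> sup01 R"
  using sup01_upper[of R] by (cases "R = {}") (force simp: sup01_def)+

lemma inf01_lower: "R \<subseteq> {0..1} \<Longrightarrow> r \<in> R \<Longrightarrow> inf01 R \<le> r"
  by (auto simp: inf01_def intro!: cInf_lower bdd_belowI[of _ 0])

lemma inf01_greatest: "(\<And>r. r \<in> R \<Longrightarrow> c \<le> r) \<Longrightarrow> c \<le> 1 \<Longrightarrow> c \<le> inf01 R"
  by (auto simp: inf01_def intro!: cInf_greatest)

lemma inf01_insert: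
  assumes "R \<subseteq> {0..1}" "r \<in> {0..1}"
  shows "inf01 (insert r R) = min r (inf01 R)"
proof (rule antisym)
  have R: "insert r R \<subseteq> {0..1}" using assms by auto
  have "inf01 (insert r R) \<le> 1" using inf01_lower[OF R, of r] assms by auto
  then show "inf01 (insert r R) \<le> min r (inf01 R)"
    using inf01_lower[OF R] by (auto intro: inf01_greatest)
  show "min r (inf01 R) \<le> inf01 (insert r R)"
    using inf01_lower[OF assms(1)] assms(2)
    by (intro inf01_greatest) (auto simp: min_le_iff_disj)
qed

lemma min_sup01:
  assumes R: "R \<subseteq> {0..1}" and r: "r \<in> {0..1}"
  shows "min r (sup01 R) = sup01 (min r ` R)"
proof (rule antisym)
  have mR: "min r ` R \<subseteq> {0..1}" using assms by (force simp: min_def)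
  show "sup01 (min r ` R) \<le> min r (sup01 R)"
    using sup01_upper[OF R] sup01_nonneg[OF R] r
    by (intro sup01_least) (auto intro: min.coboundedI2)
  show "min r (sup01 R) \<le> sup01 (min r ` R)"
  proof (cases "r \<le> sup01 (min r ` R)")
    case False
    have "s \<le> sup01 (min r ` R)" if "s \<in> R" for s
      using sup01_upper[OF mR imageI[OF that]] False by (auto simp: min_def split: if_splits)
    then have "sup01 R \<le> sup01 (min r ` R)"
      by (rule sup01_least) (auto simp: sup01_nonneg[OF mR])
    then show ?thesis by auto
  qed auto
qed


section \<open>Frames and systems\<close>

lemma is_lub_sup: "is_lub L s S \<Longrightarrow> is_lub L (\<Squnion>\<^bsub>L\<^esub> S) S"
  unfolding Lattice.sup_def by (rule someI)

lemma is_glb_inf: "is_glb L i S \<Longrightarrow> is_glb L (\<Sqinter>\<^bsub>L\<^esub> S) S"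
  unfolding Lattice.inf_def by (rule someI)

lemma sup_eqI: "partial_order L \<Longrightarrow> is_lub L s S \<Longrightarrow> \<Squnion>\<^bsub>L\<^esub> S = s"
  by (meson is_lub_sup partial_order.least_unique)

lemma inf_eqI: "partial_order L \<Longrightarrow> is_glb L i S \<Longrightarrow> \<Sqinter>\<^bsub>L\<^esub> S = i"
  by (meson is_glb_inf partial_order.greatest_unique)

lemma frame_sup_closed: "is_frame L \<Longrightarrow> S \<subseteq> carrier L \<Longrightarrow> \<Squnion>\<^bsub>L\<^esub> S \<in> carrier L"
  unfolding is_frame_def by (meson is_lub_sup least_closed)

lemma frame_inf_closed:
  "is_frame L \<Longrightarrow> finite S \<Longrightarrow> S \<subseteq> carrier L \<Longrightarrow> \<Sqinter>\<^bsub>L\<^esub> S \<in> carrier L"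
  unfolding is_frame_def by (meson is_glb_inf greatest_closed)

lemma system_frame: "is_fuzzy_system S \<Longrightarrow> is_frame (frm S)"
  by (simp add: is_fuzzy_system_def)

lemma system_gr_sup:
  "is_fuzzy_system S \<Longrightarrow> x \<in> pts S \<Longrightarrow> B \<subseteq> carrier (frm S) \<Longrightarrow>
     gr S x (\<Squnion>\<^bsub>frm S\<^esub> B) = sup01 (gr S x ` B)"
  by (simp add: is_fuzzy_system_def)

lemma system_gr_inf:
  "is_fuzzy_system S \<Longrightarrow> x \<in> pts S \<Longrightarrow> finite B \<Longrightarrow> B \<subseteq> carrier (frm S) \<Longrightarrow>
     gr S x (\<Sqinter>\<^bsub>frm S\<^esub> B) = inf01 (gr S x ` B)"
  by (simp add: is_fuzzy_system_def)

lemma system_gr_in: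
  "is_fuzzy_system S \<Longrightarrow> x \<in> pts S \<Longrightarrow> a \<in> carrier (frm S) \<Longrightarrow> gr S x a \<in> {0..1}"
  unfolding is_fuzzy_system_def by (blast dest: PiE_mem)

text \<open>
  Injectivity of \<open>ext S\<close> says that \<open>S\<close> is spatial. Then \<open>f2\<close> preserves joins because both
  \<open>f2 (\<Squnion>B)\<close> and \<open>\<Squnion>(f2 ` B)\<close> are satisfied at \<open>x\<close> to the degree \<open>sup01 (gr T (f1 x) ` B)\<close>;
  likewise for finite meets.
\<close>

lemma spatial_system_homI:
  assumes S: "is_fuzzy_system S" and T: "is_fuzzy_system T"
    and spatial: "inj_on (ext S) (carrier (frm S))"
    and f1: "f1 \<in> pts S \<rightarrow>\<^sub>E pts T"
    and f2: "f2 \<in> carrier (frm T) \<rightarrow>\<^sub>E carrier (frm S)"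
    and gr: "\<And>x b. x \<in> pts S \<Longrightarrow> b \<in> carrier (frm T) \<Longrightarrow> gr S x (f2 b) = gr T (f1 x) b"
  shows "(f1, f2) \<in> system_hom S T"
proof -
  note FS = system_frame[OF S] and FT = system_frame[OF T]
  have gr_image: "gr S x ` f2 ` B = gr T (f1 x) ` B"
    if "x \<in> pts S" "B \<subseteq> carrier (frm T)" for x B
    using that gr by (auto simp: image_image intro!: image_cong)
  have f1x: "f1 x \<in> pts T" if "x \<in> pts S" for x using f1 that by auto
  have f2B: "f2 ` B \<subseteq> carrier (frm S)" if "B \<subseteq> carrier (frm T)" for B using f2 that by auto
  have eqI: "a = b"
    if "a \<in> carrier (frm S)" "b \<in> carrier (frm S)" "\<And>x. x \<in> pts S \<Longrightarrow> gr S x a = gr S x b" for a b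
    using inj_onD[OF spatial] that by (auto simp: ext_def cong: restrict_cong)
  have "f2 (\<Squnion>\<^bsub>frm T\<^esub> B) = \<Squnion>\<^bsub>frm S\<^esub> (f2 ` B)" if B: "B \<subseteq> carrier (frm T)" for B
  proof (rule eqI)
    show "f2 (\<Squnion>\<^bsub>frm T\<^esub> B) \<in> carrier (frm S)" using f2 frame_sup_closed[OF FT B] by auto
    show "\<Squnion>\<^bsub>frm S\<^esub> (f2 ` B) \<in> carrier (frm S)" by (rule frame_sup_closed[OF FS f2B[OF B]])
    show "gr S x (f2 (\<Squnion>\<^bsub>frm T\<^esub> B)) = gr S x (\<Squnion>\<^bsub>frm S\<^esub> (f2 ` B))" if x: "x \<in> pts S" for x
      by (simp only: gr[OF x frame_sup_closed[OF FT B]] system_gr_sup[OF S x f2B[OF B]]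
          system_gr_sup[OF T f1x[OF x] B] gr_image[OF x B])
  qed
  moreover have "f2 (\<Sqinter>\<^bsub>frm T\<^esub> B) = \<Sqinter>\<^bsub>frm S\<^esub> (f2 ` B)"
    if fin: "finite B" and B: "B \<subseteq> carrier (frm T)" for B
  proof (rule eqI)
    show "f2 (\<Sqinter>\<^bsub>frm T\<^esub> B) \<in> carrier (frm S)" using f2 frame_inf_closed[OF FT fin B] by auto
    show "\<Sqinter>\<^bsub>frm S\<^esub> (f2 ` B) \<in> carrier (frm S)"
      by (rule frame_inf_closed[OF FS finite_imageI[OF fin] f2B[OF B]])
    show "gr S x (f2 (\<Sqinter>\<^bsub>frm T\<^esub> B)) = gr S x (\<Sqinter>\<^bsub>frm S\<^esub> (f2 ` B))" if x: "x \<in> pts S" for x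
      by (simp only: gr[OF x frame_inf_closed[OF FT fin B]]
          system_gr_inf[OF S x finite_imageI[OF fin] f2B[OF B]]
          system_gr_inf[OF T f1x[OF x] fin B] gr_image[OF x B])
  qed
  ultimately show ?thesis
    using f1 f2 gr by (auto simp: system_hom_def frame_hom_def)
qed


section \<open>The system of a fuzzy space\<close>

definition pointwise_sup :: "'x fuzzy_space \<Rightarrow> ('x \<Rightarrow> real) set \<Rightarrow> 'x \<Rightarrow> real" where
  "pointwise_sup X \<S> = (\<lambda>x\<in>points X. sup01 ((\<lambda>T. T x) ` \<S>))"

definition pointwise_inf :: "'x fuzzy_space \<Rightarrow> ('x \<Rightarrow> real) set \<Rightarrow> 'x \<Rightarrow> real" where
  "pointwise_inf X \<S> = (\<lambda>x\<in>points X. inf01 ((\<lambda>T. T x) ` \<S>))"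

lemma opens_in: "is_fuzzy_space X \<Longrightarrow> T \<in> opens X \<Longrightarrow> x \<in> points X \<Longrightarrow> T x \<in> {0..1}"
  unfolding is_fuzzy_space_def by (blast dest: PiE_mem)

lemma opens_values_in:
  "is_fuzzy_space X \<Longrightarrow> \<S> \<subseteq> opens X \<Longrightarrow> x \<in> points X \<Longrightarrow> (\<lambda>T. T x) ` \<S> \<subseteq> {0..1}"
  using opens_in[of X] by blast

lemma opens_eqI:
  assumes X: "is_fuzzy_space X" and "S \<in> opens X" "T \<in> opens X"
    and eq: "\<And>x. x \<in> points X \<Longrightarrow> S x = T x"
  shows "S = T"
proof (rule PiE_ext)
  show "S \<in> points X \<rightarrow>\<^sub>E {0..1}" "T \<in> points X \<rightarrow>\<^sub>E {0..1}"
    using assms by (auto simp only: is_fuzzy_space_def)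
qed (rule eq)

lemma pointwise_sup_open: "is_fuzzy_space X \<Longrightarrow> \<S> \<subseteq> opens X \<Longrightarrow> pointwise_sup X \<S> \<in> opens X"
  by (simp add: is_fuzzy_space_def pointwise_sup_def)

text \<open>
  The empty infimum is the constant \<open>1\<close>, and each further open set contributes one binary minimum.
\<close>

lemma pointwise_inf_open:
  assumes X: "is_fuzzy_space X" and "finite \<S>" "\<S> \<subseteq> opens X"
  shows "pointwise_inf X \<S> \<in> opens X"
  using assms(2,3)
proof (induction \<S>)
  case empty
  have "pointwise_inf X {} = (\<lambda>x\<in>points X. 1)" by (simp add: pointwise_inf_def inf01_def)
  then show ?case using X by (simp only: is_fuzzy_space_def)
next
  case (insert T \<S>)
  have "pointwise_inf X (insert T \<S>) = (\<lambda>x\<in>points X. min (T x) (pointwise_inf X \<S> x))"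
    using insert.prems opens_in[OF X] opens_values_in[OF X]
    by (auto simp: pointwise_inf_def inf01_insert intro!: restrict_ext)
  moreover have "(\<lambda>x\<in>points X. min (T x) (pointwise_inf X \<S> x)) \<in> opens X"
    using insert X by (simp only: is_fuzzy_space_def insert_subset)
  ultimately show ?case by metis
qed

context
  fixes \<iota> :: "('x \<Rightarrow> real) \<Rightarrow> 'a" and X :: "'x fuzzy_space"
  assumes inj: "inj \<iota>" and X: "is_fuzzy_space X"
begin

lemma opens_frame_le:
  "S \<in> opens X \<Longrightarrow> T \<in> opens X \<Longrightarrow>
     \<iota> S \<sqsubseteq>\<^bsub>opens_frame \<iota> X\<^esub> \<iota> T \<longleftrightarrow> (\<forall>x\<in>points X. S x \<le> T x)"
  by (auto simp: opens_frame_def inj_eq[OF inj])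

lemma opens_frame_carrier: "carrier (opens_frame \<iota> X) = \<iota> ` opens X"
  by (simp add: opens_frame_def)

lemma opens_frame_eq: "u .=\<^bsub>opens_frame \<iota> X\<^esub> v \<longleftrightarrow> u = v"
  by (simp add: opens_frame_def)

lemma opens_frame_partial_order: "partial_order (opens_frame \<iota> X)"
proof unfold_locales
  show "(.=\<^bsub>opens_frame \<iota> X\<^esub>) = (=)" by (simp add: opens_frame_def)
next
  fix u v
  assume "u \<sqsubseteq>\<^bsub>opens_frame \<iota> X\<^esub> v" "v \<sqsubseteq>\<^bsub>opens_frame \<iota> X\<^esub> u"
    "u \<in> carrier (opens_frame \<iota> X)" "v \<in> carrier (opens_frame \<iota> X)"
  then obtain S T where *: "S \<in> opens X" "T \<in> opens X" "u = \<iota> S" "v = \<iota> T"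
      "\<forall>x\<in>points X. S x \<le> T x" "\<forall>x\<in>points X. T x \<le> S x"
    by (auto simp: opens_frame_carrier opens_frame_le)
  then have "S = T" by (intro opens_eqI[OF X]) (auto intro: order.antisym)
  with * show "u .=\<^bsub>opens_frame \<iota> X\<^esub> v" by (simp add: opens_frame_eq)
qed (auto simp: opens_frame_carrier opens_frame_eq opens_frame_le, blast intro: order.trans)

lemma opens_frame_lub:
  assumes "\<S> \<subseteq> opens X"
  shows "is_lub (opens_frame \<iota> X) (\<iota> (pointwise_sup X \<S>)) (\<iota> ` \<S>)"
proof (rule least_UpperI)
  show "\<iota> ` \<S> \<subseteq> carrier (opens_frame \<iota> X)" using assms by (auto simp: opens_frame_carrier)
  show "\<iota> (pointwise_sup X \<S>) \<in> carrier (opens_frame \<iota> X)"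
    using pointwise_sup_open[OF X assms] by (auto simp: opens_frame_carrier)
  show "u \<sqsubseteq>\<^bsub>opens_frame \<iota> X\<^esub> \<iota> (pointwise_sup X \<S>)" if "u \<in> \<iota> ` \<S>" for u
    using that assms pointwise_sup_open[OF X assms]
    by (auto simp: opens_frame_le pointwise_sup_def subset_iff
        intro!: sup01_upper opens_values_in[OF X assms])
  show "\<iota> (pointwise_sup X \<S>) \<sqsubseteq>\<^bsub>opens_frame \<iota> X\<^esub> v"
    if v: "v \<in> Upper (opens_frame \<iota> X) (\<iota> ` \<S>)" for v
  proof -
    obtain V where V: "V \<in> opens X" "v = \<iota> V"
      using v by (auto simp: Upper_def opens_frame_carrier)
    have "T x \<le> V x" if "T \<in> \<S>" "x \<in> points X" for T x
      using v that assms V by (auto simp: Upper_def opens_frame_carrier opens_frame_le subset_iff)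
    then show ?thesis
      using V opens_in[OF X V(1)] pointwise_sup_open[OF X assms]
      by (auto simp: opens_frame_le pointwise_sup_def intro!: sup01_least)
  qed
qed

lemma opens_frame_glb:
  assumes "finite \<S>" "\<S> \<subseteq> opens X"
  shows "is_glb (opens_frame \<iota> X) (\<iota> (pointwise_inf X \<S>)) (\<iota> ` \<S>)"
proof (rule greatest_LowerI)
  show "\<iota> ` \<S> \<subseteq> carrier (opens_frame \<iota> X)" using assms by (auto simp: opens_frame_carrier)
  show "\<iota> (pointwise_inf X \<S>) \<in> carrier (opens_frame \<iota> X)"
    using pointwise_inf_open[OF X assms] by (auto simp: opens_frame_carrier)
  show "\<iota> (pointwise_inf X \<S>) \<sqsubseteq>\<^bsub>opens_frame \<iota> X\<^esub> u" if "u \<in> \<iota> ` \<S>" for u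
    using that assms pointwise_inf_open[OF X assms]
    by (auto simp: opens_frame_le pointwise_inf_def subset_iff
        intro!: inf01_lower opens_values_in[OF X assms(2)])
  show "v \<sqsubseteq>\<^bsub>opens_frame \<iota> X\<^esub> \<iota> (pointwise_inf X \<S>)"
    if v: "v \<in> Lower (opens_frame \<iota> X) (\<iota> ` \<S>)" for v
  proof -
    obtain V where V: "V \<in> opens X" "v = \<iota> V"
      using v by (auto simp: Lower_def opens_frame_carrier)
    have "V x \<le> T x" if "T \<in> \<S>" "x \<in> points X" for T x
      using v that assms V by (auto simp: Lower_def opens_frame_carrier opens_frame_le subset_iff)
    then show ?thesis
      using V opens_in[OF X V(1)] pointwise_inf_open[OF X assms]
      by (auto simp: opens_frame_le pointwise_inf_def intro!: inf01_greatest)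
  qed
qed

lemmas opens_frame_sup = sup_eqI[OF opens_frame_partial_order opens_frame_lub]
lemmas opens_frame_inf = inf_eqI[OF opens_frame_partial_order opens_frame_glb]

lemma opens_frame_meet:
  "S \<in> opens X \<Longrightarrow> T \<in> opens X \<Longrightarrow>
     \<iota> S \<sqinter>\<^bsub>opens_frame \<iota> X\<^esub> \<iota> T = \<iota> (\<lambda>x\<in>points X. min (S x) (T x))"
proof -
  assume S: "S \<in> opens X" and T: "T \<in> opens X"
  have "inf01 {S x, T x} = min (S x) (T x)" if "x \<in> points X" for x
    using opens_in[OF X S that] opens_in[OF X T that]
    by (simp add: inf01_insert) (simp add: inf01_def)
  then have "pointwise_inf X {S, T} = (\<lambda>x\<in>points X. min (S x) (T x))"
    by (auto simp: pointwise_inf_def intro!: restrict_ext)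
  then show ?thesis using opens_frame_inf[of "{S, T}"] S T by (simp add: meet_def)
qed

text \<open>
  Joins and binary meets have been identified as pointwise suprema and minima, so distributivity
  at each point is an instance of \<open>min_sup01\<close>.
\<close>

lemma opens_frame_is_frame: "is_frame (opens_frame \<iota> X)"
  unfolding is_frame_def
proof (intro conjI allI impI ballI)
  show "partial_order (opens_frame \<iota> X)" by (rule opens_frame_partial_order)
next
  fix A assume "A \<subseteq> carrier (opens_frame \<iota> X)"
  then obtain \<S> where "\<S> \<subseteq> opens X" "A = \<iota> ` \<S>" by (auto simp: opens_frame_carrier subset_image_iff)
  then show "\<exists>s. is_lub (opens_frame \<iota> X) s A" using opens_frame_lub by blast
next
  fix A assume A: "finite A \<and> A \<subseteq> carrier (opens_frame \<iota> X)"
  then obtain \<S> where "\<S> \<subseteq> opens X" "finite \<S>" "A = \<iota> ` \<S>"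
    by (auto simp: opens_frame_carrier dest: finite_subset_image)
  then show "\<exists>i. is_glb (opens_frame \<iota> X) i A" using opens_frame_glb by blast
next
  fix a A assume a: "a \<in> carrier (opens_frame \<iota> X)" and "A \<subseteq> carrier (opens_frame \<iota> X)"
  then obtain \<S> where \<S>: "\<S> \<subseteq> opens X" and A: "A = \<iota> ` \<S>"
    by (auto simp: opens_frame_carrier subset_image_iff)
  obtain S where S: "S \<in> opens X" "a = \<iota> S" using a by (auto simp: opens_frame_carrier)
  let ?m = "\<lambda>T. \<lambda>x\<in>points X. min (S x) (T x)"
  have m: "?m ` \<S> \<subseteq> opens X" using X S \<S> by (auto simp: is_fuzzy_space_def)
  have "a \<sqinter>\<^bsub>opens_frame \<iota> X\<^esub> (\<Squnion>\<^bsub>opens_frame \<iota> X\<^esub> A) = \<iota> (?m (pointwise_sup X \<S>))"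
    using S \<S> by (simp add: A opens_frame_sup opens_frame_meet pointwise_sup_open[OF X])
  also have "?m (pointwise_sup X \<S>) = pointwise_sup X (?m ` \<S>)"
    using opens_in[OF X S(1)] opens_values_in[OF X \<S>]
    by (auto simp: pointwise_sup_def min_sup01 image_image intro!: restrict_ext)
  also have "\<iota> \<dots> = \<Squnion>\<^bsub>opens_frame \<iota> X\<^esub> (\<iota> ` ?m ` \<S>)" by (simp only: opens_frame_sup[OF m])
  also have "\<iota> ` ?m ` \<S> = (\<lambda>s. a \<sqinter>\<^bsub>opens_frame \<iota> X\<^esub> s) ` A"
    using S \<S> by (auto simp: A image_image opens_frame_meet subset_iff intro!: image_cong)
  finally show "a \<sqinter>\<^bsub>opens_frame \<iota> X\<^esub> (\<Squnion>\<^bsub>opens_frame \<iota> X\<^esub> A) =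
    \<Squnion>\<^bsub>opens_frame \<iota> X\<^esub> ((\<lambda>s. a \<sqinter>\<^bsub>opens_frame \<iota> X\<^esub> s) ` A)" .
qed

lemma J_pts: "pts (on_ob (J \<iota>) X) = points X"
  and J_frm: "frm (on_ob (J \<iota>) X) = opens_frame \<iota> X"
  and J_carrier: "carrier (frm (on_ob (J \<iota>) X)) = \<iota> ` opens X"
  by (simp_all add: J_def opens_frame_def)

lemma J_gr: "x \<in> points X \<Longrightarrow> T \<in> opens X \<Longrightarrow> gr (on_ob (J \<iota>) X) x (\<iota> T) = T x"
  by (simp add: J_def inj)

lemma J_system: "is_fuzzy_system (on_ob (J \<iota>) X)"
  unfolding is_fuzzy_system_def J_pts J_frm
proof (intro conjI ballI allI impI)
  show "points X \<noteq> {}" using X by (simp add: is_fuzzy_space_def)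
  show "is_frame (opens_frame \<iota> X)" by (rule opens_frame_is_frame)
  show "gr (on_ob (J \<iota>) X) \<in> points X \<rightarrow>\<^sub>E (carrier (opens_frame \<iota> X) \<rightarrow>\<^sub>E {0..1})"
    using opens_in[OF X] by (auto simp: J_def opens_frame_carrier inj)
next
  fix x A assume x: "x \<in> points X" and A: "finite A \<and> A \<subseteq> carrier (opens_frame \<iota> X)"
  then obtain \<S> where \<S>: "\<S> \<subseteq> opens X" "finite \<S>" "A = \<iota> ` \<S>"
    by (auto simp: opens_frame_carrier dest: finite_subset_image)
  have "gr (on_ob (J \<iota>) X) x ` A = (\<lambda>T. T x) ` \<S>"
    using \<S> x by (auto simp: image_image J_gr subset_iff intro!: image_cong)
  then show "gr (on_ob (J \<iota>) X) x (\<Sqinter>\<^bsub>opens_frame \<iota> X\<^esub> A) = inf01 (gr (on_ob (J \<iota>) X) x ` A)"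
    using \<S> x by (simp add: opens_frame_inf J_gr pointwise_inf_open[OF X]) (simp add: pointwise_inf_def)
next
  fix x A assume x: "x \<in> points X" and A: "A \<subseteq> carrier (opens_frame \<iota> X)"
  then obtain \<S> where \<S>: "\<S> \<subseteq> opens X" "A = \<iota> ` \<S>"
    by (auto simp: opens_frame_carrier subset_image_iff)
  have "gr (on_ob (J \<iota>) X) x ` A = (\<lambda>T. T x) ` \<S>"
    using \<S> x by (auto simp: image_image J_gr subset_iff intro!: image_cong)
  then show "gr (on_ob (J \<iota>) X) x (\<Squnion>\<^bsub>opens_frame \<iota> X\<^esub> A) = sup01 (gr (on_ob (J \<iota>) X) x ` A)"
    using \<S> x by (simp add: opens_frame_sup J_gr pointwise_sup_open[OF X]) (simp add: pointwise_sup_def)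
qed

lemma ext_J: "T \<in> opens X \<Longrightarrow> ext (on_ob (J \<iota>) X) (\<iota> T) = T"
proof -
  assume T: "T \<in> opens X"
  then have "T \<in> extensional (points X)" using X by (auto simp: is_fuzzy_space_def PiE_def)
  with T show ?thesis by (auto simp: ext_def J_pts J_gr extensional_def)
qed

text \<open>
  The extent of a fuzzy open set is that set itself, so distinct frame elements have distinct
  extents.
\<close>

lemma J_spatial: "inj_on (ext (on_ob (J \<iota>) X)) (carrier (frm (on_ob (J \<iota>) X)))"
  by (auto simp: inj_on_def J_carrier ext_J)

text \<open>
  This is the universal property behind the adjunction. Continuity of \<open>f1\<close> is precisely what
  makes the forced values of \<open>f2\<close> lie in the frame of \<open>J X\<close>.
\<close>

lemma hom_from_J_iff:
  assumes S: "is_fuzzy_system S"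
  shows "(f1, f2) \<in> system_hom (on_ob (J \<iota>) X) S \<longleftrightarrow>
     f1 \<in> fuzzy_continuous X (on_ob Ext S) \<and>
     f2 = (\<lambda>a\<in>carrier (frm S). \<iota> (fuzzy_preimage X f1 (ext S a)))"
    (is "?hom \<longleftrightarrow> ?cont \<and> f2 = ?f2")
proof
  assume ?hom
  then have f1: "f1 \<in> points X \<rightarrow>\<^sub>E pts S"
    and f2: "f2 \<in> carrier (frm S) \<rightarrow>\<^sub>E \<iota> ` opens X"
    and gr: "\<And>x a. x \<in> points X \<Longrightarrow> a \<in> carrier (frm S) \<Longrightarrow>
       gr (on_ob (J \<iota>) X) x (f2 a) = gr S (f1 x) a"
    by (auto simp: system_hom_def frame_hom_def J_pts J_frm opens_frame_carrier)
  have pre: "fuzzy_preimage X f1 (ext S a) \<in> opens X \<and> f2 a = \<iota> (fuzzy_preimage X f1 (ext S a))"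
    if a: "a \<in> carrier (frm S)" for a
  proof -
    obtain T where T: "T \<in> opens X" "f2 a = \<iota> T" using f2 a by auto
    have "fuzzy_preimage X f1 (ext S a) = ext (on_ob (J \<iota>) X) (f2 a)"
      using f1 gr[OF _ a]
      by (auto simp: fuzzy_preimage_def compose_def ext_def J_pts intro!: restrict_ext)
    then show ?thesis using T by (simp add: ext_J)
  qed
  have "f2 = ?f2" using f2 pre by (auto simp: PiE_def extensional_def)
  with f1 pre show "?cont \<and> f2 = ?f2" by (auto simp: fuzzy_continuous_def Ext_def)
next
  assume R: "?cont \<and> f2 = ?f2"
  then have f1: "f1 \<in> points X \<rightarrow>\<^sub>E pts S"
    and pre: "\<And>a. a \<in> carrier (frm S) \<Longrightarrow> fuzzy_preimage X f1 (ext S a) \<in> opens X"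
    by (auto simp: fuzzy_continuous_def Ext_def)
  show ?hom
  proof (rule spatial_system_homI[OF J_system S J_spatial])
    show "f1 \<in> pts (on_ob (J \<iota>) X) \<rightarrow>\<^sub>E pts S" using f1 by (simp add: J_pts)
    show "f2 \<in> carrier (frm S) \<rightarrow>\<^sub>E carrier (frm (on_ob (J \<iota>) X))"
      using R pre by (auto simp: J_carrier)
    show "gr (on_ob (J \<iota>) X) x (f2 a) = gr S (f1 x) a"
      if "x \<in> pts (on_ob (J \<iota>) X)" "a \<in> carrier (frm S)" for x a
      using that f1 R pre[OF that(2)]
      by (auto simp: J_pts J_gr) (auto simp: fuzzy_preimage_def compose_def ext_def)
  qed
qed

end


section \<open>The two categories\<close>

lemma fuzzy_preimage_compose:
  "f \<in> points X \<rightarrow> points Y \<Longrightarrow>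
     fuzzy_preimage X (compose (points X) g f) T = fuzzy_preimage X f (fuzzy_preimage Y g T)"
  by (auto simp: fuzzy_preimage_def compose_def intro!: restrict_ext)

lemma fuzzy_preimage_id:
  assumes X: "is_fuzzy_space X" and T: "T \<in> opens X"
  shows "fuzzy_preimage X (\<lambda>x\<in>points X. x) T = T"
proof -
  have "T \<in> extensional (points X)" using X T by (auto simp: is_fuzzy_space_def PiE_def)
  then show ?thesis by (auto simp: fuzzy_preimage_def compose_def extensional_def)
qed

lemma fuzzy_continuous_compose:
  assumes f: "f \<in> fuzzy_continuous X Y" and g: "g \<in> fuzzy_continuous Y Z"
  shows "compose (points X) g f \<in> fuzzy_continuous X Z"
proof -
  have "f \<in> points X \<rightarrow> points Y" using f by (auto simp: fuzzy_continuous_def)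
  from fuzzy_preimage_compose[OF this, of g] f g show ?thesis
    by (auto simp: fuzzy_continuous_def compose_def)
qed

lemma fuzzy_continuous_id: "is_fuzzy_space X \<Longrightarrow> (\<lambda>x\<in>points X. x) \<in> fuzzy_continuous X X"
  by (simp add: fuzzy_continuous_def fuzzy_preimage_id)

lemma fuzzy_continuousD:
  "f \<in> fuzzy_continuous X Y \<Longrightarrow> f \<in> points X \<rightarrow> points Y"
  "f \<in> fuzzy_continuous X Y \<Longrightarrow> f \<in> extensional (points X)"
  by (auto simp: fuzzy_continuous_def PiE_def)

lemma fuzzy_Top_category: "is_category fuzzy_Top"
  unfolding is_category_def fuzzy_Top_def category.simps mem_Collect_eq
proof (intro conjI ballI)
  fix X Y and f assume "f \<in> fuzzy_continuous X Y"
  note D = fuzzy_continuousD[OF this]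
  show "compose (points X) f (\<lambda>x\<in>points X. x) = f" by (rule compose_Id[OF D])
  show "compose (points X) (\<lambda>x\<in>points Y. x) f = f" by (rule Id_compose[OF D])
next
  fix X Y Z W and f g h assume "f \<in> fuzzy_continuous X Y"
  then show "compose (points X) h (compose (points X) g f) =
      compose (points X) (compose (points Y) h g) f"
    by (rule compose_assoc[OF fuzzy_continuousD(1)])
qed (auto simp: fuzzy_continuous_id fuzzy_continuous_compose)

lemma frame_hom_id: "is_frame L \<Longrightarrow> (\<lambda>a\<in>carrier L. a) \<in> frame_hom L L"
proof -
  assume L: "is_frame L"
  have "(\<lambda>a\<in>carrier L. a) ` S = S" if "S \<subseteq> carrier L" for S using that by (auto simp: image_iff)
  then show ?thesis by (auto simp: frame_hom_def frame_sup_closed[OF L] frame_inf_closed[OF L])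
qed

lemma frame_hom_compose:
  assumes L: "is_frame L" and f: "f \<in> frame_hom L M" and g: "g \<in> frame_hom M N"
  shows "compose (carrier L) g f \<in> frame_hom L N"
proof -
  have fL: "f ` S \<subseteq> carrier M" if "S \<subseteq> carrier L" for S using f that by (auto simp: frame_hom_def)
  have img: "compose (carrier L) g f ` S = g ` f ` S" if "S \<subseteq> carrier L" for S
    using that by (auto simp: compose_def image_image subset_iff intro!: image_cong)
  have "compose (carrier L) g f \<in> carrier L \<rightarrow>\<^sub>E carrier N"
    using f g by (auto simp: frame_hom_def compose_def)
  moreover have "compose (carrier L) g f (\<Squnion>\<^bsub>L\<^esub> S) = \<Squnion>\<^bsub>N\<^esub> (compose (carrier L) g f ` S)"
    if "S \<subseteq> carrier L" for S
    using f g that fL[OF that] frame_sup_closed[OF L that]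
    by (simp add: img) (simp add: frame_hom_def compose_def)
  moreover have "compose (carrier L) g f (\<Sqinter>\<^bsub>L\<^esub> S) = \<Sqinter>\<^bsub>N\<^esub> (compose (carrier L) g f ` S)"
    if "finite S" "S \<subseteq> carrier L" for S
    using f g that fL[OF that(2)] frame_inf_closed[OF L that]
    by (simp add: img) (simp add: frame_hom_def compose_def)
  ultimately show ?thesis by (auto simp: frame_hom_def)
qed

lemma system_hom_id:
  "is_fuzzy_system S \<Longrightarrow> (\<lambda>x\<in>pts S. x, \<lambda>a\<in>carrier (frm S). a) \<in> system_hom S S"
  by (auto simp: system_hom_def frame_hom_id system_frame)

lemma system_hom_compose:
  assumes U: "is_fuzzy_system U" and f: "f \<in> system_hom S T" and g: "g \<in> system_hom T U"
  shows "(compose (pts S) (fst g) (fst f), compose (carrier (frm U)) (snd f) (snd g)) \<in> system_hom S U"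
proof -
  have "compose (carrier (frm U)) (snd f) (snd g) \<in> frame_hom (frm U) (frm S)"
    using f g by (intro frame_hom_compose[OF system_frame[OF U]]) (auto simp: system_hom_def)
  moreover have "snd g \<in> carrier (frm U) \<rightarrow> carrier (frm T)"
    using g by (auto simp: system_hom_def frame_hom_def)
  moreover have "fst f x \<in> pts T" if "x \<in> pts S" for x using f that by (auto simp: system_hom_def)
  moreover have "fst g y \<in> pts U" if "y \<in> pts T" for y using g that by (auto simp: system_hom_def)
  ultimately show ?thesis
    using f g by (auto simp: system_hom_def compose_def Pi_iff)
qed

lemma system_homD:
  assumes "f \<in> system_hom S T"
  shows "fst f \<in> pts S \<rightarrow> pts T" "fst f \<in> extensional (pts S)"
    "snd f \<in> carrier (frm T) \<rightarrow> carrier (frm S)" "snd f \<in> extensional (carrier (frm T))"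
  using assms by (auto simp: system_hom_def frame_hom_def PiE_def)

lemma fuzzy_TopSys_category: "is_category fuzzy_TopSys"
  unfolding is_category_def fuzzy_TopSys_def category.simps mem_Collect_eq
proof (intro conjI ballI)
  fix S T and f assume "f \<in> system_hom S T"
  note D = system_homD[OF this]
  show "(compose (pts S) (fst f) (fst (\<lambda>x\<in>pts S. x, \<lambda>a\<in>carrier (frm S). a)),
      compose (carrier (frm T)) (snd (\<lambda>x\<in>pts S. x, \<lambda>a\<in>carrier (frm S). a)) (snd f)) = f"
    using D by (simp add: compose_Id Id_compose)
  show "(compose (pts S) (fst (\<lambda>x\<in>pts T. x, \<lambda>a\<in>carrier (frm T). a)) (fst f),
      compose (carrier (frm T)) (snd f) (snd (\<lambda>x\<in>pts T. x, \<lambda>a\<in>carrier (frm T). a))) = f"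
    using D by (simp add: compose_Id Id_compose)
next
  fix S T U V and f g h
  assume f: "f \<in> system_hom S T" and g: "g \<in> system_hom T U" and h: "h \<in> system_hom U V"
  show "(compose (pts S) (fst h) (fst (compose (pts S) (fst g) (fst f),
          compose (carrier (frm U)) (snd f) (snd g))),
      compose (carrier (frm V)) (snd (compose (pts S) (fst g) (fst f),
          compose (carrier (frm U)) (snd f) (snd g))) (snd h)) =
    (compose (pts S) (fst (compose (pts T) (fst h) (fst g),
          compose (carrier (frm V)) (snd g) (snd h))) (fst f),
      compose (carrier (frm V)) (snd f) (snd (compose (pts T) (fst h) (fst g),
          compose (carrier (frm V)) (snd g) (snd h))))"
    using compose_assoc[OF system_homD(1)[OF f], of "fst h" "fst g"]
      compose_assoc[OF system_homD(3)[OF h], of "snd f" "snd g"] by simp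
qed (auto simp: system_hom_id system_hom_compose)

section \<open>The functors\<close>

text \<open>
  The extent map turns joins and finite meets of the frame into pointwise suprema and infima.
  Closure of the extents under these operations is therefore inherited from the frame; the
  constants \<open>0\<close> and \<open>1\<close> are the extents of the empty join and the empty meet.
\<close>

lemma Ext_space:
  assumes S: "is_fuzzy_system S"
  shows "is_fuzzy_space (on_ob Ext S)"
proof -
  let ?A = "carrier (frm S)"
  note F = system_frame[OF S]
  have sup: "ext S (\<Squnion>\<^bsub>frm S\<^esub> B) = (\<lambda>x\<in>pts S. sup01 ((\<lambda>T. T x) ` ext S ` B))" if "B \<subseteq> ?A" for B
    using that by (auto simp: ext_def system_gr_sup[OF S] image_image intro!: restrict_ext)
  have inf: "ext S (\<Sqinter>\<^bsub>frm S\<^esub> B) = (\<lambda>x\<in>pts S. inf01 ((\<lambda>T. T x) ` ext S ` B))"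
    if "finite B" "B \<subseteq> ?A" for B
    using that by (auto simp: ext_def system_gr_inf[OF S] image_image intro!: restrict_ext)
  have "(\<lambda>x\<in>pts S. sup01 ((\<lambda>T. T x) ` \<S>)) \<in> ext S ` ?A" if "\<S> \<subseteq> ext S ` ?A" for \<S>
  proof -
    obtain B where "B \<subseteq> ?A" "\<S> = ext S ` B" using \<open>\<S> \<subseteq> ext S ` ?A\<close> by (auto simp: subset_image_iff)
    then show ?thesis using frame_sup_closed[OF F] sup by (metis imageI)
  qed
  moreover have "(\<lambda>x\<in>pts S. min (ext S a x) (ext S b x)) \<in> ext S ` ?A"
    if ab: "a \<in> ?A" "b \<in> ?A" for a b
  proof -
    have "inf01 {gr S x a, gr S x b} = min (gr S x a) (gr S x b)" if "x \<in> pts S" for x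
      using system_gr_in[OF S that ab(1)] system_gr_in[OF S that ab(2)]
      by (simp add: inf01_insert) (simp add: inf01_def)
    then have "ext S (\<Sqinter>\<^bsub>frm S\<^esub> {a, b}) = (\<lambda>x\<in>pts S. min (ext S a x) (ext S b x))"
      using ab inf[of "{a, b}"] by (auto simp: ext_def intro!: restrict_ext)
    then show ?thesis using frame_inf_closed[OF F, of "{a, b}"] ab by (metis empty_subsetI finite.simps imageI insert_subset)
  qed
  moreover have "(\<lambda>x\<in>pts S. 0) \<in> ext S ` ?A" "(\<lambda>x\<in>pts S. 1) \<in> ext S ` ?A"
    using sup[of "{}"] inf[of "{}"] frame_sup_closed[OF F, of "{}"] frame_inf_closed[OF F, of "{}"]
    by (auto simp: sup01_def inf01_def intro: rev_image_eqI)
  moreover have "ext S ` ?A \<subseteq> pts S \<rightarrow>\<^sub>E {0..1}"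
    using system_gr_in[OF S] by (auto simp: ext_def)
  moreover have "pts S \<noteq> {}" using S by (simp add: is_fuzzy_system_def)
  ultimately show ?thesis by (auto simp: is_fuzzy_space_def Ext_def)
qed

text \<open>
  The point map pulls \<open>ext T b\<close> back to \<open>ext S (f2 b)\<close>: this is the satisfaction condition,
  read pointwise.
\<close>

lemma Ext_continuous:
  assumes f: "f \<in> system_hom S T"
  shows "fst f \<in> fuzzy_continuous (on_ob Ext S) (on_ob Ext T)"
proof -
  obtain f1 f2 where eq: "f = (f1, f2)" by (cases f)
  have f1: "f1 \<in> pts S \<rightarrow>\<^sub>E pts T" and f2: "f2 \<in> carrier (frm T) \<rightarrow>\<^sub>E carrier (frm S)"
    and gr: "\<And>x b. x \<in> pts S \<Longrightarrow> b \<in> carrier (frm T) \<Longrightarrow> gr S x (f2 b) = gr T (f1 x) b"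
    using f by (auto simp: eq system_hom_def frame_hom_def)
  have "fuzzy_preimage (on_ob Ext S) f1 (ext T b) = ext S (f2 b)" if "b \<in> carrier (frm T)" for b
    using that f1 gr by (auto simp: fuzzy_preimage_def compose_def ext_def Ext_def intro!: restrict_ext)
  then show ?thesis using f1 f2 by (auto simp: eq fuzzy_continuous_def Ext_def)
qed

lemma Ext_points: "points (on_ob Ext S) = pts S"
  and Ext_arrow: "on_hom Ext S T f = fst f"
  by (simp_all add: Ext_def)

lemma Ext_functor: "is_functor fuzzy_TopSys fuzzy_Top Ext"
  unfolding is_functor_def
proof (intro conjI fuzzy_Top_category fuzzy_TopSys_category)
qed (simp_all add: fuzzy_Top_def fuzzy_TopSys_def Ext_space Ext_continuous Ext_points Ext_arrow)

lemma Ext_J: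
  assumes inj: "inj \<iota>" and X: "is_fuzzy_space X"
  shows "on_ob Ext (on_ob (J \<iota>) X) = X"
proof -
  have "ext (on_ob (J \<iota>) X) ` \<iota> ` opens X = opens X"
    using ext_J[OF inj X] by (simp add: image_image)
  then show ?thesis
    using J_pts[OF inj X] J_carrier[OF inj X] by (simp add: Ext_def)
qed

text \<open>
  A continuous map into \<open>Y = Ext (J Y)\<close> determines a morphism into \<open>J Y\<close>, and its forced frame part
  agrees with the preimage map in the definition of \<open>J\<close>, because \<open>ext (J Y)\<close> inverts \<open>\<iota>\<close>.
\<close>

lemma J_hom:
  assumes inj: "inj \<iota>" and X: "is_fuzzy_space X" and Y: "is_fuzzy_space Y"
    and f: "f \<in> fuzzy_continuous X Y"
  shows "on_hom (J \<iota>) X Y f \<in> system_hom (on_ob (J \<iota>) X) (on_ob (J \<iota>) Y)"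
proof -
  have "(\<lambda>u\<in>\<iota> ` opens Y. \<iota> (fuzzy_preimage X f (inv \<iota> u))) =
     (\<lambda>a\<in>carrier (frm (on_ob (J \<iota>) Y)). \<iota> (fuzzy_preimage X f (ext (on_ob (J \<iota>) Y) a)))"
    unfolding J_carrier[OF inj Y]
    by (rule restrict_ext) (auto simp: ext_J[OF inj Y] inj)
  then have "(f, \<lambda>u\<in>\<iota> ` opens Y. \<iota> (fuzzy_preimage X f (inv \<iota> u)))
      \<in> system_hom (on_ob (J \<iota>) X) (on_ob (J \<iota>) Y)"
    using f by (simp add: hom_from_J_iff[OF inj X J_system[OF inj Y]] Ext_J[OF inj Y])
  then show ?thesis by (simp add: J_def)
qed

text \<open>
  The functor laws of \<open>J\<close> follow from this: they equate morphisms out of some \<open>J X\<close> whose point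
  maps visibly agree.
\<close>

lemma hom_from_J_eqI:
  assumes "inj \<iota>" "is_fuzzy_space X" "is_fuzzy_system S"
    and "f \<in> system_hom (on_ob (J \<iota>) X) S" "g \<in> system_hom (on_ob (J \<iota>) X) S" "fst f = fst g"
  shows "f = g"
  using assms(4-6) hom_from_J_iff[OF assms(1-3)] by (cases f; cases g) simp

lemma J_functor:
  fixes \<iota> :: "('x \<Rightarrow> real) \<Rightarrow> 'a"
  assumes inj: "inj \<iota>"
  shows "is_functor fuzzy_Top fuzzy_TopSys (J \<iota>)"
  unfolding is_functor_def
proof (intro conjI fuzzy_Top_category fuzzy_TopSys_category ballI)
  fix X :: "'x fuzzy_space" assume "X \<in> Ob fuzzy_Top"
  then have X: "is_fuzzy_space X" by (simp add: fuzzy_Top_def)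
  show "on_ob (J \<iota>) X \<in> Ob fuzzy_TopSys" by (simp add: fuzzy_TopSys_def J_system[OF inj X])
  have "(\<lambda>x\<in>points X. x) \<in> fuzzy_continuous X X"
    using X fuzzy_Top_category by (auto simp: is_category_def fuzzy_Top_def)
  from J_hom[OF inj X X this]
  show "on_hom (J \<iota>) X X (Id fuzzy_Top X) = Id fuzzy_TopSys (on_ob (J \<iota>) X)"
    unfolding fuzzy_Top_def fuzzy_TopSys_def
    by (auto intro!: hom_from_J_eqI[OF inj X J_system[OF inj X]] system_hom_id J_system[OF inj X])
      (simp add: J_def)
next
  fix X Y :: "'x fuzzy_space" and f
  assume "X \<in> Ob fuzzy_Top" "Y \<in> Ob fuzzy_Top" "f \<in> Hom fuzzy_Top X Y"
  then show "on_hom (J \<iota>) X Y f \<in> Hom fuzzy_TopSys (on_ob (J \<iota>) X) (on_ob (J \<iota>) Y)"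
    by (simp add: fuzzy_Top_def fuzzy_TopSys_def J_hom[OF inj])
next
  fix X Y Z :: "'x fuzzy_space" and f g
  assume "X \<in> Ob fuzzy_Top" "Y \<in> Ob fuzzy_Top" "Z \<in> Ob fuzzy_Top"
    and "f \<in> Hom fuzzy_Top X Y" "g \<in> Hom fuzzy_Top Y Z"
  then have X: "is_fuzzy_space X" and Y: "is_fuzzy_space Y" and Z: "is_fuzzy_space Z"
    and f: "f \<in> fuzzy_continuous X Y" and g: "g \<in> fuzzy_continuous Y Z"
    by (simp_all add: fuzzy_Top_def)
  have "on_hom (J \<iota>) X Z (compose (points X) g f) =
    (compose (points X) (fst (on_hom (J \<iota>) Y Z g)) (fst (on_hom (J \<iota>) X Y f)),
     compose (carrier (frm (on_ob (J \<iota>) Z))) (snd (on_hom (J \<iota>) X Y f)) (snd (on_hom (J \<iota>) Y Z g)))"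
    (is "_ = ?c")
  proof (rule hom_from_J_eqI[OF inj X J_system[OF inj Z]])
    show "on_hom (J \<iota>) X Z (compose (points X) g f) \<in> system_hom (on_ob (J \<iota>) X) (on_ob (J \<iota>) Z)"
      by (rule J_hom[OF inj X Z fuzzy_continuous_compose[OF f g]])
    show "?c \<in> system_hom (on_ob (J \<iota>) X) (on_ob (J \<iota>) Z)"
      using system_hom_compose[OF J_system[OF inj Z] J_hom[OF inj X Y f] J_hom[OF inj Y Z g]]
      by (simp add: J_pts[OF inj X])
  qed (simp add: J_def)
  then show "on_hom (J \<iota>) X Z (comp fuzzy_Top X Y Z g f) =
    comp fuzzy_TopSys (on_ob (J \<iota>) X) (on_ob (J \<iota>) Y) (on_ob (J \<iota>) Z)
      (on_hom (J \<iota>) Y Z g) (on_hom (J \<iota>) X Y f)"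
    by (simp add: fuzzy_Top_def fuzzy_TopSys_def J_pts[OF inj X])
qed


section \<open>The adjunction\<close>

lemma bij_betw_fst_hom_from_J:
  assumes "inj \<iota>" "is_fuzzy_space X" "is_fuzzy_system S"
  shows "bij_betw fst (system_hom (on_ob (J \<iota>) X) S) (fuzzy_continuous X (on_ob Ext S))"
proof (rule bij_betwI')
  fix f g assume "f \<in> system_hom (on_ob (J \<iota>) X) S" "g \<in> system_hom (on_ob (J \<iota>) X) S"
  then show "(fst f = fst g) = (f = g)" using hom_from_J_eqI[OF assms] by blast
next
  fix f assume "f \<in> system_hom (on_ob (J \<iota>) X) S"
  then show "fst f \<in> fuzzy_continuous X (on_ob Ext S)"
    using hom_from_J_iff[OF assms, of "fst f" "snd f"] by simp
next
  fix h assume "h \<in> fuzzy_continuous X (on_ob Ext S)"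
  then show "\<exists>f\<in>system_hom (on_ob (J \<iota>) X) S. h = fst f"
    using hom_from_J_iff[OF assms, of h] by force
qed

theorem lemma2p2p13:
  fixes \<iota> :: "('x \<Rightarrow> real) \<Rightarrow> 'a"
  assumes "inj \<iota>"
  shows "is_right_adjoint
           (fuzzy_Top :: ('x fuzzy_space, 'x \<Rightarrow> 'x) category)
           (fuzzy_TopSys :: (('x, 'a) fuzzy_system, ('x \<Rightarrow> 'x) \<times> ('a \<Rightarrow> 'a)) category)
           (J \<iota>) Ext"
  unfolding is_right_adjoint_def
  \<comment> \<open>Since the bijection forgets the frame part, naturality is an equation between composites of
    point maps and holds by unfolding.\<close>
proof (intro conjI J_functor Ext_functor assms exI[where x = "\<lambda>c d. fst"] ballI)
  fix X :: "'x fuzzy_space" and S :: "('x, 'a) fuzzy_system"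
  assume "X \<in> Ob fuzzy_Top" "S \<in> Ob fuzzy_TopSys"
  then show "bij_betw fst (Hom fuzzy_TopSys (on_ob (J \<iota>) X) S) (Hom fuzzy_Top X (on_ob Ext S))"
    using bij_betw_fst_hom_from_J[OF assms] by (simp add: fuzzy_Top_def fuzzy_TopSys_def)
qed (simp_all add: fuzzy_Top_def fuzzy_TopSys_def J_def Ext_def)

end
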